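(* Let $N,n\ge 1$, let $x_0,x_1,\dots,x_{N-1}$ be $\mathbb{R}^n$-valued random vectors such that the stacked vector $z=(x_0^\top,x_1^\top,\dots,x_{N-1}^\top)^\top\in\mathbb{R}^{Nn}$ is normally distributed with mean $\mu\in\mathbb{R}^{Nn}$ and symmetric positive definite covariance matrix $\Sigma\in\mathbb{R}^{Nn\times Nn}$. Let $Q\in\mathbb{R}^{n\times n}$ be symmetric positive definite, let $\Omega=\operatorname{diag}(Q,\dots,Q)\in\mathbb{R}^{Nn\times Nn}$ (block diagonal with $N$ copies of $Q$), and let $$J_N=z^\top\Omega z=\sum_{k=0}^{N-1}x_k^\top Q x_k .$$ Then for every real $\xi\in\bigl(-\infty,\tfrac{1}{2\lambda_{\max}(\Omega\Sigma)}\bigr)$ the moment generating function $M_{J_N}(\xi)=\mathbb{E}[e^{\xi J_N}]$ is given by $$M_{J_N}(\xi)=\frac{\exp\!\left(\tfrac12\,\mu^\top\bigl((I-2\xi\Omega\Sigma)^{-1}-I\bigr)\Sigma^{-1}\mu\right)}{\sqrt{\det(I-2\xi\Omega\Sigma)}} .$$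
   Context: $\lambda_{\max}(\Omega\Sigma)$ denotes the largest eigenvalue of $\Omega\Sigma$ (all eigenvalues of $\Omega\Sigma$ are real, since $\Omega$ and $\Sigma$ are symmetric and $\Sigma$ is positive definite). $I$ is the identity matrix of size $Nn$. *)

theory Defs
  imports "HOL-Probability.Probability"
begin

definition sym_pos_def :: "real ^ 'n ^ 'n \<Rightarrow> bool" where
  "sym_pos_def A \<longleftrightarrow> transpose A = A \<and> (\<forall>v. v \<noteq> 0 \<longrightarrow> v \<bullet> (A *v v) > 0)"

definition real_eigenvalues :: "real ^ 'n ^ 'n \<Rightarrow> real set" where
  "real_eigenvalues A = {c. \<exists>v. v \<noteq> 0 \<and> A *v v = c *\<^sub>R v}"

text \<open>
  Only meant for matrices all of whose complex eigenvalues are real, such as the product of a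
  symmetric and a positive definite matrix: there the set is finite and nonempty.
\<close>

definition lambda_max :: "real ^ 'n ^ 'n \<Rightarrow> real" where
  "lambda_max A = Max (real_eigenvalues A)"

text \<open>
  A stacked vector of blocks of length \<open>CARD('n)\<close>, one for each index in \<open>'k\<close>, is indexed by pairs:
  the entry at \<open>(k, i)\<close> is the \<open>i\<close>-th coordinate of the \<open>k\<close>-th block.
\<close>

definition stack :: "('k::finite \<Rightarrow> real ^ 'n) \<Rightarrow> real ^ ('k \<times> 'n)" where
  "stack x = (\<chi> p. x (fst p) $ snd p)"

definition block_diag :: "real ^ 'n ^ 'n \<Rightarrow> real ^ ('k::finite \<times> 'n) ^ ('k \<times> 'n)" where
  "block_diag Q = (\<chi> p q. if fst p = fst q then Q $ snd p $ snd q else 0)"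

definition mvn_density :: "real ^ 'd \<Rightarrow> real ^ 'd ^ 'd \<Rightarrow> real ^ 'd \<Rightarrow> real" where
  "mvn_density \<mu> \<Sigma> y =
     exp (- (1 / 2) * ((y - \<mu>) \<bullet> (matrix_inv \<Sigma> *v (y - \<mu>)))) / sqrt ((2 * pi) ^ CARD('d) * det \<Sigma>)"

text \<open>
  The nondegenerate normal law, given by its Lebesgue density; used only with a symmetric positive
  definite covariance matrix \<open>\<Sigma>\<close>.
\<close>

definition normally_distributed ::
  "'a measure \<Rightarrow> ('a \<Rightarrow> real ^ 'd) \<Rightarrow> real ^ 'd \<Rightarrow> real ^ 'd ^ 'd \<Rightarrow> bool" where
  "normally_distributed M z \<mu> \<Sigma> \<longleftrightarrow> distributed M lborel z (\<lambda>y. ennreal (mvn_density \<mu> \<Sigma> y))"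

text \<open>
  The Bochner integral is 0 for a non-integrable function, so this is the moment generating
  function only where \<open>\<lambda>\<omega>. exp (\<xi> * X \<omega>)\<close> is integrable.
\<close>

definition mgf :: "'a measure \<Rightarrow> ('a \<Rightarrow> real) \<Rightarrow> real \<Rightarrow> real" where
  "mgf M X \<xi> = integral\<^sup>L M (\<lambda>\<omega>. exp (\<xi> * X \<omega>))"

end

theory Submission
  imports Defs
begin

text \<open>
  Completing the square in the density times \<open>exp (\<xi> z\<^sup>T \<Omega> z)\<close> leaves a Gaussian integral with precision
  matrix \<open>A = \<Sigma>\<^sup>-\<^sup>1 - 2 \<xi> \<Omega>\<close>, and \<open>I - 2 \<xi> \<Omega> \<Sigma> = A \<Sigma>\<close> turns its value into the stated one. The bound
  on \<open>\<xi>\<close> makes \<open>A\<close> positive definite, because \<open>\<lambda>\<^sub>m\<^sub>a\<^sub>x(\<Omega> \<Sigma>)\<close> dominates the Rayleigh quotient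
  \<open>y\<^sup>T \<Omega> y / y\<^sup>T \<Sigma>\<^sup>-\<^sup>1 y\<close>. The Gaussian integral is reduced to the standard one by a
  linear substitution \<open>V\<close> with \<open>V\<^sup>T A V = I\<close>.
\<close>

section \<open>Symmetric positive definite matrices\<close>

lemma matrix_inv_mult:
  fixes A :: "real ^ 'n ^ 'n"
  assumes "det A \<noteq> 0"
  shows "A ** matrix_inv A = mat 1" "matrix_inv A ** A = mat 1"
proof -
  have "invertible A"
    using assms by (simp add: invertible_det_nz)
  then have "A ** matrix_inv A = mat 1 \<and> matrix_inv A ** A = mat 1"
    unfolding invertible_def matrix_inv_def by (rule someI_ex)
  then show "A ** matrix_inv A = mat 1" "matrix_inv A ** A = mat 1"
    by auto
qed

lemma matrix_inv_eqI:
  fixes A B :: "real ^ 'n ^ 'n"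
  assumes "A ** B = mat 1"
  shows "matrix_inv A = B"
proof -
  have "det A * det B = 1"
    using assms by (metis det_I det_mul)
  then have "det A \<noteq> 0"
    by auto
  have "matrix_inv A = matrix_inv A ** (A ** B)"
    by (simp add: assms)
  also have "\<dots> = B"
    by (simp add: matrix_mul_assoc matrix_inv_mult \<open>det A \<noteq> 0\<close>)
  finally show ?thesis .
qed

lemma matrix_mult_diff_rdistrib:
  fixes A B :: "real ^ 'n ^ 'm" and C :: "real ^ 'p ^ 'n"
  shows "(A - B) ** C = A ** C - B ** C"
  by (simp add: matrix_matrix_mult_def vec_eq_iff left_diff_distrib sum_subtractf)

lemma inner_matrix_vector_symmetric:
  fixes A :: "real ^ 'n ^ 'n"
  assumes "transpose A = A"
  shows "u \<bullet> (A *v v) = v \<bullet> (A *v u)"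
  by (metis assms dot_lmul_matrix inner_commute transpose_matrix_vector)

lemma inner_matrix_vector_eq:
  fixes A B :: "real ^ 'n ^ 'n"
  shows "(B *v u) \<bullet> (A *v (B *v v)) = u \<bullet> ((transpose B ** A ** B) *v v)"
  by (metis dot_lmul_matrix matrix_vector_mul_assoc vector_transpose_matrix)

lemma sym_pos_defD:
  fixes A :: "real ^ 'n ^ 'n"
  assumes "sym_pos_def A"
  shows "transpose A = A" "v \<noteq> 0 \<Longrightarrow> 0 < v \<bullet> (A *v v)"
  using assms by (auto simp: sym_pos_def_def)

text \<open>Gram-Schmidt for the inner product \<open>(u, v) \<mapsto> u \<bullet> (A *v v)\<close>.\<close>

lemma sym_pos_def_orthonormal_family:
  fixes A :: "real ^ 'n ^ 'n" and S :: "'n set"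
  assumes "sym_pos_def A"
  shows "\<exists>v :: 'n \<Rightarrow> real ^ 'n. \<forall>i\<in>S. \<forall>j\<in>S. v i \<bullet> (A *v v j) = of_bool (i = j)"
proof -
  have "finite S"
    by simp
  then show ?thesis
  proof (induction S rule: finite_induct)
    case empty
    then show ?case by simp
  next
    case (insert k S)
    then obtain v :: "'n \<Rightarrow> real ^ 'n" where v: "\<And>i j. i \<in> S \<Longrightarrow> j \<in> S \<Longrightarrow> v i \<bullet> (A *v v j) = of_bool (i = j)"
      by blast
    \<comment> \<open>Fewer than \<open>CARD('n)\<close> vectors \<open>A *v v j\<close> cannot span
      the space, so some nonzero \<open>w\<close> is Euclidean-orthogonal to all of them; this is
      orthogonality to each \<open>v j\<close> in the form of \<open>A\<close>.\<close>
    have "dim ((\<lambda>j. A *v v j) ` S) \<le> card S"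
      by (meson card_image_le dim_le_card' finite_imageI insert.hyps(1) order_trans)
    also have "\<dots> < CARD('n)"
      using insert.hyps(2) by (intro psubset_card_mono) auto
    finally have "dim ((\<lambda>j. A *v v j) ` S) < DIM(real ^ 'n)"
      by simp
    then obtain w where "w \<noteq> 0"
      and "\<And>y. y \<in> span ((\<lambda>j. A *v v j) ` S) \<Longrightarrow> orthogonal w y"
      by (rule orthogonal_to_subspace_exists) blast
    then have w: "w \<bullet> (A *v v j) = 0" if "j \<in> S" for j
      using that by (simp add: orthogonal_def span_base)
    define c where "c = w \<bullet> (A *v w)"
    have "c > 0"
      unfolding c_def using sym_pos_defD(2)[OF assms \<open>w \<noteq> 0\<close>] .
    define u where "u = (1 / sqrt c) *\<^sub>R w"
    have "u \<bullet> (A *v u) = 1"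
      using \<open>c > 0\<close> by (simp add: u_def matrix_vector_mult_scaleR flip: c_def)
    moreover have "u \<bullet> (A *v v j) = 0" "v j \<bullet> (A *v u) = 0" if "j \<in> S" for j
    proof -
      show "u \<bullet> (A *v v j) = 0"
        using w[OF that] by (simp add: u_def)
      then show "v j \<bullet> (A *v u) = 0"
        by (metis assms inner_matrix_vector_symmetric sym_pos_defD(1))
    qed
    ultimately have "\<forall>i\<in>insert k S. \<forall>j\<in>insert k S. (v(k := u)) i \<bullet> (A *v (v(k := u)) j) = of_bool (i = j)"
      using v insert.hyps(2) by auto
    then show ?case
      by blast
  qed
qed

text \<open>The columns of \<open>V\<close> are a basis orthonormal for the form of
  \<open>A\<close>, and the entries of \<open>transpose V ** A ** V\<close> are their pairings. The
  determinant identity later gives \<open>0 < det A\<close> and the Jacobian of the substitution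
  \<open>V\<close>.\<close>

lemma sym_pos_def_congruent_mat_1:
  fixes A :: "real ^ 'n ^ 'n"
  assumes "sym_pos_def A"
  obtains V :: "real ^ 'n ^ 'n" where "transpose V ** A ** V = mat 1" "(det V)\<^sup>2 * det A = 1"
proof -
  obtain v :: "'n \<Rightarrow> real ^ 'n" where v: "\<And>i j. v i \<bullet> (A *v v j) = of_bool (i = j)"
    using sym_pos_def_orthonormal_family[OF assms, of UNIV] by auto
  define V :: "real ^ 'n ^ 'n" where "V = (\<chi> i j. v j $ i)"
  have V: "V *v axis j 1 = v j" for j
    by (simp add: V_def vec_eq_iff matrix_vector_mul_component inner_axis)
  have "(transpose V ** A ** V) $ i $ j = mat 1 $ i $ j" for i j
  proof -
    have "(transpose V ** A ** V) $ i $ j = axis i 1 \<bullet> ((transpose V ** A ** V) *v axis j 1)"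
      by (simp add: inner_axis' matrix_vector_mul_component inner_axis)
    also have "\<dots> = v i \<bullet> (A *v v j)"
      by (simp only: V flip: inner_matrix_vector_eq)
    finally show ?thesis
      by (simp add: v mat_def)
  qed
  then have V1: "transpose V ** A ** V = mat 1"
    by (simp add: vec_eq_iff)
  then have "det V * det A * det V = 1"
    by (metis det_I det_mul det_transpose)
  with V1 show thesis
    by (intro that[of V]) (simp_all add: power2_eq_square mult_ac)
qed

lemma sym_pos_def_det:
  fixes A :: "real ^ 'n ^ 'n"
  assumes "sym_pos_def A"
  shows "0 < det A"
proof -
  obtain V :: "real ^ 'n ^ 'n" where "(det V)\<^sup>2 * det A = 1"
    using sym_pos_def_congruent_mat_1[OF assms] .
  then show ?thesis
    by (metis zero_less_mult_pos zero_less_one zero_less_power2 mult_zero_left power_zero_numeral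
        zero_neq_one)
qed

lemma sym_pos_def_matrix_inv:
  fixes A :: "real ^ 'n ^ 'n"
  assumes "sym_pos_def A"
  shows "sym_pos_def (matrix_inv A)"
proof -
  note A = sym_pos_defD[OF assms]
  have inv: "A ** matrix_inv A = mat 1" "matrix_inv A ** A = mat 1"
    using sym_pos_def_det[OF assms] by (simp_all add: matrix_inv_mult)
  have "A ** transpose (matrix_inv A) = mat 1"
    using arg_cong[OF inv(2), of transpose] by (simp add: matrix_transpose_mul A(1) transpose_mat)
  then have sym: "transpose (matrix_inv A) = matrix_inv A"
    using matrix_inv_eqI by metis
  have "0 < v \<bullet> (matrix_inv A *v v)" if "v \<noteq> 0" for v
  proof -
    define w where "w = matrix_inv A *v v"
    have v: "v = A *v w"
      by (simp add: w_def matrix_vector_mul_assoc inv)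
    with that have "w \<noteq> 0"
      by auto
    then have "0 < w \<bullet> (A *v w)"
      by (rule A(2))
    then show ?thesis
      by (simp add: v[symmetric] inner_commute flip: w_def)
  qed
  with sym show ?thesis
    by (simp add: sym_pos_def_def)
qed

section \<open>Semidefinite forms and the largest eigenvalue of a product\<close>

text \<open>If \<open>w = C *v u\<close> were nonzero, the form at \<open>u + s *\<^sub>R w\<close>
  would be \<open>2 * s * (w \<bullet> w) + s\<^sup>2 * q\<close>, which is negative for small
  negative \<open>s\<close>.\<close>

lemma positive_semidefinite_kernel:
  fixes C :: "real ^ 'n ^ 'n"
  assumes sym: "transpose C = C" and nonneg: "\<And>y. 0 \<le> y \<bullet> (C *v y)" and zero: "u \<bullet> (C *v u) = 0"
  shows "C *v u = 0"
proof -
  define w where "w = C *v u"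
  define q where "q = w \<bullet> (C *v w)"
  \<comment> \<open>The \<open>+ 1\<close> keeps the step defined when \<open>q = 0\<close>;
    \<open>2 * t + t\<^sup>2 * q\<close> becomes \<open>- (q + 2) / (q + 1)\<^sup>2\<close>. Scaling
    the step by \<open>w \<bullet> w\<close> below lets \<open>(w \<bullet> w)\<^sup>2\<close>
    factor out.\<close>
  define t where "t = - (1 / (q + 1))"
  have "q \<ge> 0"
    unfolding q_def by (rule nonneg)
  have uw: "u \<bullet> (C *v w) = w \<bullet> w"
    using inner_matrix_vector_symmetric[OF sym, of u w] by (simp add: w_def)
  have uw0: "u \<bullet> w = 0"
    using zero by (simp add: w_def)
  have "0 \<le> (u + (t * (w \<bullet> w)) *\<^sub>R w) \<bullet> (C *v (u + (t * (w \<bullet> w)) *\<^sub>R w))"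
    by (rule nonneg)
  also have "\<dots> = 2 * t * (w \<bullet> w)\<^sup>2 + t\<^sup>2 * (w \<bullet> w)\<^sup>2 * q"
    by (simp add: matrix_vector_right_distrib matrix_vector_mult_scaleR inner_add_left inner_add_right
        uw uw0 inner_commute[of w u] q_def power2_eq_square algebra_simps flip: w_def)
  also have "\<dots> = (w \<bullet> w)\<^sup>2 * (- (q + 2) / (q + 1)\<^sup>2)"
    using \<open>q \<ge> 0\<close> by (simp add: t_def divide_simps power2_eq_square) algebra
  finally have "0 \<le> (w \<bullet> w)\<^sup>2 * (- (q + 2) / (q + 1)\<^sup>2)" .
  moreover have "- (q + 2) / (q + 1)\<^sup>2 < 0"
    using \<open>q \<ge> 0\<close> by (intro divide_neg_pos) auto
  ultimately have "(w \<bullet> w)\<^sup>2 = 0"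
    by (smt (verit) mult_pos_neg zero_le_power2)
  then show ?thesis
    by (simp add: w_def)
qed

text \<open>Finiteness makes the \<open>Max\<close> in \<open>lambda_max\<close> an upper bound.
  Eigenvectors to distinct eigenvalues are orthogonal in the form of \<open>C\<close>, hence
  Euclidean-orthogonal in the coordinates given by a congruence \<open>V\<close>, hence independent,
  and the dimension is finite.\<close>

lemma finite_real_eigenvalues_mult:
  fixes B C :: "real ^ 'n ^ 'n"
  assumes B: "transpose B = B" and C: "sym_pos_def C"
  shows "finite (real_eigenvalues (B ** C))"
proof -
  let ?E = "real_eigenvalues (B ** C)"
  have "\<forall>c\<in>?E. \<exists>w. w \<noteq> 0 \<and> (B ** C) *v w = c *\<^sub>R w"
    by (auto simp: real_eigenvalues_def)
  then obtain w where w0: "\<And>c. c \<in> ?E \<Longrightarrow> w c \<noteq> 0"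
    and w: "\<And>c. c \<in> ?E \<Longrightarrow> B *v (C *v w c) = c *\<^sub>R w c"
    by (metis matrix_vector_mul_assoc)
  have orth: "w d \<bullet> (C *v w c) = 0" if "c \<in> ?E" "d \<in> ?E" "c \<noteq> d" for c d
  proof -
    \<comment> \<open>By symmetry of \<open>B\<close>, the product \<open>B ** C\<close> is
      self-adjoint for the form of \<open>C\<close>.\<close>
    have "(C *v w d) \<bullet> (B *v (C *v w c)) = (C *v w c) \<bullet> (B *v (C *v w d))"
      by (rule inner_matrix_vector_symmetric[OF B])
    then have "c * (w c \<bullet> (C *v w d)) = d * (w d \<bullet> (C *v w c))"
      by (simp add: w that inner_commute)
    then have "(c - d) * (w d \<bullet> (C *v w c)) = 0"
      by (simp add: inner_matrix_vector_symmetric[OF sym_pos_defD(1)[OF C], of "w c"] algebra_simps)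
    with that show ?thesis by simp
  qed
  obtain V :: "real ^ 'n ^ 'n" where V: "transpose V ** C ** V = mat 1"
    using sym_pos_def_congruent_mat_1[OF C] .
  \<comment> \<open>A left inverse of a square matrix is also a right inverse, so \<open>u c\<close>
    is the coordinate vector of \<open>w c\<close> with respect to the columns of
    \<open>V\<close>.\<close>
  then have "V ** (transpose V ** C) = mat 1"
    using matrix_left_right_inverse by blast
  then have VW: "V *v ((transpose V ** C) *v x) = x" for x
    by (simp add: matrix_vector_mul_assoc)
  define u where "u c = (transpose V ** C) *v w c" for c
  have wu: "w c = V *v u c" for c
    by (simp add: u_def VW)
  have u_orth: "u d \<bullet> u c = 0" if "c \<in> ?E" "d \<in> ?E" "c \<noteq> d" for c d
    using orth[OF that] by (simp add: wu inner_matrix_vector_eq V)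
  have u0: "u c \<noteq> 0" if "c \<in> ?E" for c
    using w0[OF that] by (auto simp: wu)
  \<comment> \<open>Equal values at distinct eigenvalues would make a nonzero vector orthogonal to
    itself. Injectivity carries finiteness from the image back to the eigenvalues.\<close>
  have "inj_on u ?E"
    by (rule inj_onI) (metis inner_eq_zero_iff u0 u_orth)
  moreover have "independent (u ` ?E)"
  proof (rule pairwise_orthogonal_independent)
    show "pairwise orthogonal (u ` ?E)"
      by (auto simp: pairwise_def orthogonal_def) (metis u_orth)
    show "0 \<notin> u ` ?E"
      using u0 by force
  qed
  ultimately show ?thesis
    using finite_imageD independent_imp_finite by blast
qed

text \<open>
  The maximum \<open>c\<close> of the generalised Rayleigh quotient is an eigenvalue of \<open>B ** C\<close>: at a maximiser
  \<open>v\<close> the positive semidefinite form of \<open>c C\<^sup>-\<^sup>1 - B\<close> vanishes, so that \<open>B v = c C\<^sup>-\<^sup>1 v\<close>, and \<open>C\<^sup>-\<^sup>1 v\<close>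
  is an eigenvector.
\<close>

lemma quadratic_form_le_lambda_max:
  fixes B C :: "real ^ 'n ^ 'n"
  assumes B: "transpose B = B" and C: "sym_pos_def C"
  shows "y \<bullet> (B *v y) \<le> lambda_max (B ** C) * (y \<bullet> (matrix_inv C *v y))"
proof -
  define S where "S = matrix_inv C"
  have S: "sym_pos_def S"
    unfolding S_def by (rule sym_pos_def_matrix_inv[OF C])
  have CS: "C ** S = mat 1"
    using sym_pos_def_det[OF C] by (simp add: S_def matrix_inv_mult)
  \<comment> \<open>\<open>R\<close> is invariant under scaling, so its maximum on the compact unit
    sphere bounds it at every nonzero vector.\<close>
  define R where "R y = (y \<bullet> (B *v y)) / (y \<bullet> (S *v y))" for y
  have "continuous_on (sphere 0 1) R"
    unfolding R_def
  proof (intro continuous_intros ballI)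
    fix y :: "real ^ 'n"
    assume "y \<in> sphere 0 1"
    then have "y \<noteq> 0" by auto
    then show "y \<bullet> (S *v y) \<noteq> 0"
      using sym_pos_defD(2)[OF S] by force
  qed
  moreover have "sphere (0 :: real ^ 'n) 1 \<noteq> {}"
    by simp
  ultimately obtain v where v: "v \<in> sphere 0 1" and max: "\<And>y. y \<in> sphere 0 1 \<Longrightarrow> R y \<le> R v"
    using continuous_attains_sup[OF compact_sphere] by metis
  define c where "c = R v"
  have bound: "y \<bullet> (B *v y) \<le> c * (y \<bullet> (S *v y))" for y
  proof (cases "y = 0")
    case False
    then have "0 < y \<bullet> (S *v y)"
      by (rule sym_pos_defD(2)[OF S])
    have "R ((1 / norm y) *\<^sub>R y) \<le> c"
      unfolding c_def using False by (intro max) simp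
    moreover have "R ((1 / norm y) *\<^sub>R y) = R y"
      using False by (simp add: R_def matrix_vector_mult_scaleR)
    ultimately have "R y \<le> c"
      by simp
    with \<open>0 < y \<bullet> (S *v y)\<close> show ?thesis
      by (simp add: R_def pos_divide_le_eq)
  qed simp
  have "v \<noteq> 0"
    using v by auto
  define D where "D = c *\<^sub>R S - B"
  have Dv: "D *v y = c *\<^sub>R (S *v y) - B *v y" for y
    by (simp add: D_def matrix_vector_mult_diff_rdistrib scaleR_matrix_vector_assoc)
  have "D *v v = 0"
  proof (rule positive_semidefinite_kernel)
    show "transpose D = D"
      using B sym_pos_defD(1)[OF S] by (simp add: D_def transpose_def vec_eq_iff)
    show "0 \<le> y \<bullet> (D *v y)" for y
      using bound[of y] by (simp add: Dv inner_diff_right)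
    show "v \<bullet> (D *v v) = 0"
      using sym_pos_defD(2)[OF S \<open>v \<noteq> 0\<close>] by (simp add: Dv inner_diff_right c_def R_def)
  qed
  then have Bv: "B *v v = c *\<^sub>R (S *v v)"
    by (simp add: Dv)
  have "(B ** C) *v (S *v v) = B *v ((C ** S) *v v)"
    by (simp add: matrix_vector_mul_assoc matrix_mul_assoc)
  also have "\<dots> = c *\<^sub>R (S *v v)"
    by (simp add: CS Bv)
  finally have "(B ** C) *v (S *v v) = c *\<^sub>R (S *v v)" .
  moreover have "S *v v \<noteq> 0"
    using sym_pos_defD(2)[OF S \<open>v \<noteq> 0\<close>] by auto
  ultimately have "c \<in> real_eigenvalues (B ** C)"
    by (auto simp: real_eigenvalues_def)
  then have "c \<le> lambda_max (B ** C)"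
    unfolding lambda_max_def using finite_real_eigenvalues_mult[OF B C] by simp
  moreover have "0 \<le> y \<bullet> (S *v y)"
    using sym_pos_defD(2)[OF S, of y] by (cases "y = 0") auto
  ultimately have "c * (y \<bullet> (S *v y)) \<le> lambda_max (B ** C) * (y \<bullet> (S *v y))"
    by (rule mult_right_mono)
  with bound[of y] show ?thesis
    by (simp add: S_def)
qed

section \<open>Stacked vectors\<close>

lemma stack_block_diag:
  fixes x :: "'k::finite \<Rightarrow> real ^ 'n" and Q :: "real ^ 'n ^ 'n"
  shows "stack x \<bullet> (block_diag Q *v stack x) = (\<Sum>k\<in>UNIV. x k \<bullet> (Q *v x k))"
proof -
  have "(block_diag Q *v stack x) $ p = (Q *v x (fst p)) $ snd p" for p
  proof -
    have "(block_diag Q *v stack x) $ p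
        = (\<Sum>q\<in>UNIV \<times> UNIV. (if fst p = fst q then Q $ snd p $ snd q else 0) * x (fst q) $ snd q)"
      by (simp add: matrix_vector_mult_def block_diag_def stack_def)
    also have "\<dots> = (\<Sum>l\<in>UNIV. \<Sum>j\<in>UNIV. (if fst p = l then Q $ snd p $ j else 0) * x l $ j)"
      by (subst sum.cartesian_product) (simp add: case_prod_unfold)
    also have "\<dots> = (\<Sum>l\<in>UNIV. if fst p = l then \<Sum>j\<in>UNIV. Q $ snd p $ j * x l $ j else 0)"
      by (intro sum.cong) auto
    also have "\<dots> = (Q *v x (fst p)) $ snd p"
      by (simp add: matrix_vector_mult_def)
    finally show ?thesis .
  qed
  then have "stack x \<bullet> (block_diag Q *v stack x)
      = (\<Sum>p\<in>UNIV \<times> UNIV. x (fst p) $ snd p * (Q *v x (fst p)) $ snd p)"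
    by (simp add: inner_vec_def) (simp add: stack_def)
  also have "\<dots> = (\<Sum>k\<in>UNIV. \<Sum>i\<in>UNIV. x k $ i * (Q *v x k) $ i)"
    by (subst sum.cartesian_product) (simp add: case_prod_unfold)
  finally show ?thesis
    by (simp add: inner_vec_def)
qed

text \<open>Every vector is the stack of its blocks, so the form is a sum of values of the form of
  \<open>Q\<close>, and a nonzero vector has a nonzero block.\<close>

lemma sym_pos_def_block_diag:
  fixes Q :: "real ^ 'n ^ 'n"
  assumes Q: "sym_pos_def Q"
  shows "sym_pos_def (block_diag Q :: real ^ ('k::finite \<times> 'n) ^ ('k \<times> 'n))"
proof -
  have "Q $ j $ i = Q $ i $ j" for i j
    using arg_cong[OF sym_pos_defD(1)[OF Q], of "\<lambda>A. A $ i $ j"] by (simp add: transpose_def)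
  then have "transpose (block_diag Q) = (block_diag Q :: real ^ ('k \<times> 'n) ^ ('k \<times> 'n))"
    by (simp add: block_diag_def transpose_def vec_eq_iff)
  moreover have "0 < v \<bullet> (block_diag Q *v v)" if "v \<noteq> 0" for v :: "real ^ ('k \<times> 'n)"
  proof -
    define x where "x k = (\<chi> i. v $ (k, i))" for k
    have v: "v = stack x"
      by (simp add: stack_def x_def vec_eq_iff)
    have nonneg: "0 \<le> x k \<bullet> (Q *v x k)" for k
      using sym_pos_defD(2)[OF Q, of "x k"] by (cases "x k = 0") auto
    have "\<exists>k. x k \<noteq> 0"
    proof (rule ccontr)
      assume "\<nexists>k. x k \<noteq> 0"
      then have "v = 0"
        by (simp add: v stack_def vec_eq_iff)
      with that show False by simp
    qed
    then obtain k where "x k \<noteq> 0" ..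
    then have "0 < x k \<bullet> (Q *v x k)"
      by (rule sym_pos_defD(2)[OF Q])
    then have "0 < (\<Sum>k\<in>UNIV. x k \<bullet> (Q *v x k))"
      using nonneg by (intro sum_pos2[of _ k]) auto
    then show ?thesis
      by (simp add: v stack_block_diag)
  qed
  ultimately show ?thesis
    by (simp add: sym_pos_def_def)
qed

section \<open>Linear change of variables\<close>

text \<open>
  The library has this for well-ordered index types only, where the shears are triangular; the index
  type \<open>'k \<times> 'n\<close> of a stacked vector carries no order.
\<close>

lemma measure_matrix_image:
  fixes A :: "real ^ 'n ^ 'n"
  assumes "S \<in> lmeasurable"
  shows "(*v) A ` S \<in> lmeasurable \<and> measure lebesgue ((*v) A ` S) = \<bar>det A\<bar> * measure lebesgue S"
  using assms
proof (induction A arbitrary: S rule: induct_matrix_elementary_alt[case_names mult zero_row diagonal swap1 idplus])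
  case (mult A B)
  have "(*v) (A ** B) ` S = (*v) A ` (*v) B ` S"
    by (simp add: image_image matrix_vector_mul_assoc)
  then show ?case
    using mult by (simp add: det_mul abs_mult)
next
  case (zero_row A i)
  have "det A = 0"
    using zero_row.hyps by (rule det_zero_row)
  \<comment> \<open>A singular map has its image in a proper subspace, which matches the factor
    \<open>det A = 0\<close>.\<close>
  then have "negligible ((*v) A ` S)"
    by (intro negligible_linear_singular_image matrix_vector_mul_linear)
      (simp add: inj_matrix_vector_mult invertible_det_nz flip: det_nz_iff_inj)
  then show ?case
    by (simp add: \<open>det A = 0\<close> negligible_iff_measure)
next
  case (diagonal A)
  have "A *v x = (\<chi> i. A $ i $ i * x $ i)" for x
  proof -
    have "(\<Sum>j\<in>UNIV. A $ i $ j * x $ j) = (\<Sum>j\<in>UNIV. if i = j then A $ i $ i * x $ i else 0)" for i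
      by (intro sum.cong) (auto simp: diagonal.hyps)
    then show ?thesis
      by (simp add: matrix_vector_mult_def vec_eq_iff)
  qed
  then have "(*v) A = (\<lambda>x. \<chi> i. A $ i $ i * x $ i)"
    by auto
  then show ?case
    using measurable_stretch[OF diagonal.prems] measure_stretch[OF diagonal.prems] diagonal.hyps
    by (simp add: det_diagonal)
next
  case (swap1 m n)
  let ?t = "Transposition.transpose m n"
  \<comment> \<open>\<open>W\<close> swaps two coordinates: it maps a box to a box with permuted
    side lengths. By \<open>measure_linear_sufficient\<close> the scaling factor of a linear map can
    be read off from boxes.\<close>
  define W :: "real ^ 'n ^ 'n" where "W = (\<chi> i j. mat 1 $ i $ ?t j)"
  have W: "W *v x = (\<chi> i. x $ ?t i)" for x
  proof -
    have "i = ?t j \<longleftrightarrow> j = ?t i" for i j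
      by (metis transpose_involutory)
    then have "(W *v x) $ i = (\<Sum>j\<in>UNIV. if j = ?t i then x $ j else 0)" for i
      by (simp add: W_def matrix_vector_mult_def mat_def if_distrib[of "\<lambda>c. c * y" for y] cong: if_cong)
    then show ?thesis
      by (simp add: vec_eq_iff)
  qed
  have "measure lebesgue ((*v) W ` cbox a b) = measure lebesgue (cbox a b)" for a b
  proof (cases "cbox a b = {}")
    case False
    have eq: "(*v) W ` cbox a b = cbox (W *v a) (W *v b)"
    proof
      show "(*v) W ` cbox a b \<subseteq> cbox (W *v a) (W *v b)"
        by (auto simp: W mem_box_cart)
      show "cbox (W *v a) (W *v b) \<subseteq> (*v) W ` cbox a b"
      proof
        fix y
        assume y: "y \<in> cbox (W *v a) (W *v b)"
        have "a $ i \<le> y $ ?t i \<and> y $ ?t i \<le> b $ i" for i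
          using y by (simp add: W mem_box_cart) (metis transpose_involutory)
        then have "W *v y \<in> cbox a b"
          by (simp add: W mem_box_cart)
        moreover have "y = W *v (W *v y)"
          by (simp add: W vec_eq_iff)
        ultimately show "y \<in> (*v) W ` cbox a b"
          by blast
      qed
    qed
    have "cbox (W *v a) (W *v b) \<noteq> {}"
      using False by (auto simp flip: eq)
    then have "measure lebesgue ((*v) W ` cbox a b) = (\<Prod>i\<in>UNIV. b $ ?t i - a $ ?t i)"
      unfolding eq by (simp add: content_cbox_cart W)
    also have "\<dots> = (\<Prod>i\<in>UNIV. b $ i - a $ i)"
      by (rule prod.reindex_bij_betw[of ?t UNIV UNIV "\<lambda>i. b $ i - a $ i"]) simp
    also have "\<dots> = measure lebesgue (cbox a b)"
      using False by (simp add: content_cbox_cart)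
    finally show ?thesis .
  qed simp
  moreover have "\<bar>det W\<bar> = 1"
    unfolding W_def by (simp add: det_permute_columns permutes_swap_id sign_swap_id abs_mult)
  ultimately show ?case
    using measure_linear_sufficient[OF matrix_vector_mul_linear swap1.prems, of W 1]
    by (simp flip: W_def)
next
  case (idplus m n)
  define W :: "real ^ 'n ^ 'n" where "W = (\<chi> i j. of_bool (i = m \<and> j = n \<or> i = j))"
  have W: "W *v x = (\<chi> i. if i = m then x $ m + x $ n else x $ i)" for x
  proof -
    have "(W *v x) $ i = (\<Sum>j\<in>UNIV. (if j = i then x $ j else 0) + (if j = n then if i = m then x $ n else 0 else 0))" for i
      unfolding W_def matrix_vector_mult_def using idplus.hyps by (auto intro!: sum.cong)
    then show ?thesis
      by (simp add: vec_eq_iff sum.distrib)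
  qed
  have "measure lebesgue ((*v) W ` cbox a b) = measure lebesgue (cbox a b)" for a b
  proof (cases "cbox a b = {}")
    case False
    \<comment> \<open>\<open>measure_shear_interval\<close> asks for a nonnegative
      \<open>n\<close>-th coordinate of the lower corner. Translation by \<open>t\<close> makes it
      0, and a linear map carries translates to translates, so no measure changes.\<close>
    define t where "t = axis n (- (a $ n))"
    have box: "cbox (t + a) (t + b) = (+) t ` cbox a b"
      by (rule cbox_translation)
    have "(*v) W ` cbox (t + a) (t + b) = (+) (W *v t) ` (*v) W ` cbox a b"
      by (simp add: box image_image matrix_vector_right_distrib)
    then have "measure lebesgue ((*v) W ` cbox a b) = measure lebesgue ((*v) W ` cbox (t + a) (t + b))"
      by (simp add: measure_translation)
    also have "\<dots> = measure lebesgue (cbox (t + a) (t + b))"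
    proof -
      have "cbox (t + a) (t + b) \<noteq> {}"
        unfolding box using False by simp
      moreover have "0 \<le> (t + a) $ n"
        by (simp add: t_def)
      ultimately show ?thesis
        using measure_shear_interval[OF idplus.hyps] by (simp add: W[abs_def])
    qed
    also have "\<dots> = measure lebesgue (cbox a b)"
      by (simp only: box measure_translation)
    finally show ?thesis .
  qed simp
  moreover have "det W = 1"
  proof -
    \<comment> \<open>The shear matrix is the identity with row \<open>n\<close> added to row
      \<open>m\<close>.\<close>
    have "W = (\<chi> k. if k = m then row m (mat 1) + 1 *s row n (mat 1) else row k (mat 1))"
      using idplus.hyps by (auto simp: W_def vec_eq_iff row_def mat_def)
    then show ?thesis
      by (simp only: det_row_operation[OF idplus.hyps] det_I)
  qed
  ultimately show ?case
    using measure_linear_sufficient[OF matrix_vector_mul_linear idplus.prems, of W 1]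
    unfolding W_def[symmetric] by simp
qed

text \<open>A Borel measure giving every open box its volume is Lebesgue measure. The image of
  Lebesgue measure under \<open>A\<close>, scaled by \<open>\<bar>det A\<bar>\<close>, does so,
  since \<open>A\<close> maps the preimage of a box back onto the box.\<close>

lemma nn_integral_lborel_matrix:
  fixes A :: "real ^ 'n ^ 'n"
  assumes "det A \<noteq> 0" and f [measurable]: "f \<in> borel_measurable borel"
  shows "(\<integral>\<^sup>+ x. f x \<partial>lborel) = ennreal \<bar>det A\<bar> * (\<integral>\<^sup>+ x. f (A *v x) \<partial>lborel)"
proof -
  have [measurable]: "(*v) A \<in> borel \<rightarrow>\<^sub>M borel"
    by (intro borel_measurable_continuous_onI continuous_intros)
  have "lborel = scale_measure (ennreal \<bar>det A\<bar>) (distr lborel borel ((*v) A))"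
  proof (rule lborel_eqI)
    fix l u :: "real ^ 'n"
    assume lu: "\<And>b. b \<in> Basis \<Longrightarrow> l \<bullet> b \<le> u \<bullet> b"
    define B where "B = matrix_inv A"
    have AB: "A *v (B *v x) = x" and BA: "B *v (A *v x) = x" for x
      using assms by (simp_all add: B_def matrix_vector_mul_assoc matrix_inv_mult)
    \<comment> \<open>Written as an image under the inverse, the preimage is measurable by
      \<open>measure_matrix_image\<close>.\<close>
    have pre: "(*v) A -` box l u = (*v) B ` box l u"
      by (force simp: AB BA image_iff)
    have img: "(*v) A ` (*v) A -` box l u = box l u"
      by (auto simp: image_iff) (metis AB)
    have "box l u \<in> lmeasurable"
      by simp
    then have S: "(*v) A -` box l u \<in> lmeasurable"
      unfolding pre using measure_matrix_image by blast
    have "emeasure lborel ((*v) A -` box l u) = ennreal (measure lebesgue ((*v) A -` box l u))"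
    proof -
      have "(*v) A -` box l u \<in> sets lborel"
        using measurable_sets_borel[of "(*v) A" lborel "box l u"] by simp
      then have "emeasure lborel ((*v) A -` box l u) = emeasure lebesgue ((*v) A -` box l u)"
        by simp
      also have "\<dots> = ennreal (measure lebesgue ((*v) A -` box l u))"
        using S by (intro emeasure_eq_measure2) simp
      finally show ?thesis .
    qed
    then have "ennreal \<bar>det A\<bar> * emeasure lborel ((*v) A -` box l u)
        = ennreal (\<bar>det A\<bar> * measure lebesgue ((*v) A -` box l u))"
      by (simp add: ennreal_mult)
    also have "\<bar>det A\<bar> * measure lebesgue ((*v) A -` box l u) = measure lebesgue (box l u)"
      using measure_matrix_image[OF S, of A] unfolding img by simp
    also have "\<dots> = (\<Prod>b\<in>Basis. (u - l) \<bullet> b)"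
      using lu by simp
    finally show "emeasure (scale_measure (ennreal \<bar>det A\<bar>) (distr lborel borel ((*v) A))) (box l u)
        = (\<Prod>b\<in>Basis. (u - l) \<bullet> b)"
      by (simp add: emeasure_distr)
  qed simp
  then have "(\<integral>\<^sup>+ x. f x \<partial>lborel)
      = (\<integral>\<^sup>+ x. f x \<partial>scale_measure (ennreal \<bar>det A\<bar>) (distr lborel borel ((*v) A)))"
    by simp
  then show ?thesis
    by (simp add: nn_integral_scale_measure nn_integral_distr)
qed

section \<open>Gaussian integrals\<close>

text \<open>The integrand is a product over coordinates of unnormalised standard normal densities,
  each of total mass \<open>sqrt (2 * pi)\<close>.\<close>

lemma nn_integral_gaussian:
  "(\<integral>\<^sup>+ x. ennreal (exp (- (1 / 2) * (x \<bullet> x))) \<partial>(lborel :: (real ^ 'n) measure))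
    = ennreal (sqrt ((2 * pi) ^ CARD('n)))"
proof -
  have one: "(\<integral>\<^sup>+ t. ennreal (exp (- (t\<^sup>2 / 2))) \<partial>lborel) = ennreal (sqrt (2 * pi))"
  proof -
    have "(\<integral>\<^sup>+ t. ennreal (std_normal_density t) \<partial>lborel) = 1"
      using prob_space.emeasure_space_1[OF prob_space_normal_density[of 1 0]]
      by (simp add: emeasure_density)
    then have "ennreal (sqrt (2 * pi)) * (\<integral>\<^sup>+ t. ennreal (std_normal_density t) \<partial>lborel) = ennreal (sqrt (2 * pi))"
      by simp
    then show ?thesis
      by (simp add: std_normal_density_def flip: nn_integral_cmult ennreal_mult)
  qed
  have "ennreal (exp (- (1 / 2) * (x \<bullet> x))) = (\<Prod>b\<in>Basis. ennreal (exp (- ((x \<bullet> b)\<^sup>2 / 2))))" for x :: "real ^ 'n"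
    by (simp add: euclidean_inner[of x x] prod_ennreal power2_eq_square flip: exp_sum)
      (simp add: sum_negf sum_divide_distrib)
  then have "(\<integral>\<^sup>+ x. ennreal (exp (- (1 / 2) * (x \<bullet> x))) \<partial>(lborel :: (real ^ 'n) measure))
      = (\<integral>\<^sup>+ x. (\<Prod>b\<in>Basis. ennreal (exp (- ((x \<bullet> b)\<^sup>2 / 2)))) \<partial>(lborel :: (real ^ 'n) measure))"
    by simp
  also have "\<dots> = ennreal (sqrt (2 * pi)) ^ CARD('n)"
    by (subst nn_integral_lborel_prod) (simp_all add: one)
  also have "\<dots> = ennreal (sqrt ((2 * pi) ^ CARD('n)))"
    by (subst real_sqrt_power) (simp add: ennreal_power)
  finally show ?thesis .
qed

text \<open>Translation moves the centre to 0, and the substitution \<open>V\<close> leaves the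
  standard integral with Jacobian \<open>\<bar>det V\<bar> = 1 / sqrt (det A)\<close>.\<close>

lemma nn_integral_gaussian_form:
  fixes A :: "real ^ 'n ^ 'n"
  assumes "sym_pos_def A"
  shows "(\<integral>\<^sup>+ y. ennreal (exp (- (1 / 2) * ((y - m) \<bullet> (A *v (y - m))))) \<partial>lborel)
    = ennreal (sqrt ((2 * pi) ^ CARD('n) / det A))"
proof -
  obtain V :: "real ^ 'n ^ 'n" where V: "transpose V ** A ** V = mat 1" and detV: "(det V)\<^sup>2 * det A = 1"
    using sym_pos_def_congruent_mat_1[OF assms] .
  then have "det V \<noteq> 0"
    by auto
  have [measurable]: "(\<lambda>y. A *v y) \<in> borel_measurable borel"
    by (intro borel_measurable_continuous_onI continuous_intros)
  have "(\<integral>\<^sup>+ y. ennreal (exp (- (1 / 2) * ((y - m) \<bullet> (A *v (y - m))))) \<partial>lborel)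
      = (\<integral>\<^sup>+ y. ennreal (exp (- (1 / 2) * ((y - m) \<bullet> (A *v (y - m))))) \<partial>distr lborel borel ((+) m))"
    by (simp only: lborel_distr_plus)
  also have "\<dots> = (\<integral>\<^sup>+ y. ennreal (exp (- (1 / 2) * (y \<bullet> (A *v y)))) \<partial>lborel)"
    by (subst nn_integral_distr) simp_all
  also have "\<dots> = ennreal \<bar>det V\<bar> * (\<integral>\<^sup>+ u. ennreal (exp (- (1 / 2) * ((V *v u) \<bullet> (A *v (V *v u))))) \<partial>lborel)"
    using \<open>det V \<noteq> 0\<close> by (rule nn_integral_lborel_matrix) simp
  also have "\<dots> = ennreal \<bar>det V\<bar> * ennreal (sqrt ((2 * pi) ^ CARD('n)))"
    unfolding inner_matrix_vector_eq V matrix_vector_mul_lid nn_integral_gaussian ..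
  also have "\<dots> = ennreal (sqrt ((det V)\<^sup>2 * (2 * pi) ^ CARD('n)))"
    by (simp add: real_sqrt_mult flip: ennreal_mult)
  also have "(det V)\<^sup>2 = 1 / det A"
    using detV by (metis mult_zero_right nonzero_eq_divide_eq zero_neq_one)
  finally show ?thesis
    by simp
qed

section \<open>Moment generating function of a quadratic form\<close>

lemma mvn_density_times_exp_quadratic_form:
  fixes \<Sigma> \<Omega> :: "real ^ 'n ^ 'n" and \<mu> :: "real ^ 'n" and \<xi> :: real
  defines "A \<equiv> matrix_inv \<Sigma> - (2 * \<xi>) *\<^sub>R \<Omega>"
  defines "b \<equiv> matrix_inv \<Sigma> *v \<mu>"
  assumes \<Sigma>: "sym_pos_def \<Sigma>" and A: "sym_pos_def A"
  shows "mvn_density \<mu> \<Sigma> y * exp (\<xi> * (y \<bullet> (\<Omega> *v y)))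
    = exp (1 / 2 * (b \<bullet> (matrix_inv A *v b) - \<mu> \<bullet> b)) / sqrt ((2 * pi) ^ CARD('n) * det \<Sigma>)
      * exp (- (1 / 2) * ((y - matrix_inv A *v b) \<bullet> (A *v (y - matrix_inv A *v b))))"
proof -
  let ?S = "matrix_inv \<Sigma>"
  \<comment> \<open>With \<open>A *v m = b\<close> both squares have the same linear term
    \<open>- 2 * (y \<bullet> b)\<close>; only the constants \<open>m \<bullet> b\<close> and
    \<open>\<mu> \<bullet> b\<close> remain, and they form the prefactor.\<close>
  define m where "m = matrix_inv A *v b"
  have Am: "A *v m = b"
    using sym_pos_def_det[OF A] by (simp add: m_def matrix_vector_mul_assoc matrix_inv_mult)
  have Ay: "A *v y = ?S *v y - (2 * \<xi>) *\<^sub>R (\<Omega> *v y)"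
    by (simp add: A_def matrix_vector_mult_diff_rdistrib scaleR_matrix_vector_assoc)
  have "m \<bullet> (A *v y) = y \<bullet> b"
    using inner_matrix_vector_symmetric[OF sym_pos_defD(1)[OF A], of m y] by (simp add: Am)
  then have square_A: "(y - m) \<bullet> (A *v (y - m)) = y \<bullet> (?S *v y) - 2 * \<xi> * (y \<bullet> (\<Omega> *v y)) - 2 * (y \<bullet> b) + m \<bullet> b"
    by (simp add: matrix_vector_mult_diff_distrib inner_diff_left inner_diff_right Am) (simp add: Ay inner_diff_right)
  have "\<mu> \<bullet> (?S *v y) = y \<bullet> b"
    unfolding b_def by (rule inner_matrix_vector_symmetric[OF sym_pos_defD(1)[OF sym_pos_def_matrix_inv[OF \<Sigma>]]])
  then have square_S: "(y - \<mu>) \<bullet> (?S *v (y - \<mu>)) = y \<bullet> (?S *v y) - 2 * (y \<bullet> b) + \<mu> \<bullet> b"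
    by (simp add: matrix_vector_mult_diff_distrib inner_diff_left inner_diff_right flip: b_def)
  have "- (1 / 2) * ((y - \<mu>) \<bullet> (?S *v (y - \<mu>))) + \<xi> * (y \<bullet> (\<Omega> *v y))
      = 1 / 2 * (b \<bullet> m - \<mu> \<bullet> b) + - (1 / 2) * ((y - m) \<bullet> (A *v (y - m)))"
    unfolding square_A square_S by (simp add: inner_commute[of b m] field_simps)
  then have "exp (- (1 / 2) * ((y - \<mu>) \<bullet> (?S *v (y - \<mu>)))) * exp (\<xi> * (y \<bullet> (\<Omega> *v y)))
      = exp (1 / 2 * (b \<bullet> m - \<mu> \<bullet> b)) * exp (- (1 / 2) * ((y - m) \<bullet> (A *v (y - m))))"
    by (simp only: exp_add[symmetric])
  then show ?thesis
    by (simp only: mvn_density_def times_divide_eq_left m_def)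
qed

text \<open>The integrand is nonnegative, so a finite nonnegative integral yields integrability and
  the expectation together.\<close>

lemma has_bochner_integral_exp_quadratic_form:
  fixes \<Sigma> \<Omega> :: "real ^ 'n ^ 'n" and \<mu> :: "real ^ 'n" and \<xi> :: real
  defines "A \<equiv> matrix_inv \<Sigma> - (2 * \<xi>) *\<^sub>R \<Omega>"
  defines "b \<equiv> matrix_inv \<Sigma> *v \<mu>"
  assumes \<Sigma>: "sym_pos_def \<Sigma>" and A: "sym_pos_def A"
    and z: "normally_distributed M z \<mu> \<Sigma>"
  shows "has_bochner_integral M (\<lambda>\<omega>. exp (\<xi> * (z \<omega> \<bullet> (\<Omega> *v z \<omega>))))
    (exp (1 / 2 * (b \<bullet> (matrix_inv A *v b) - \<mu> \<bullet> b)) / sqrt (det A * det \<Sigma>))"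
proof (rule has_bochner_integral_nn_integral)
  have dist: "distributed M lborel z (\<lambda>y. ennreal (mvn_density \<mu> \<Sigma> y))"
    using z by (simp add: normally_distributed_def)
  have [measurable]: "z \<in> borel_measurable M"
    using distributed_measurable[OF dist] by simp
  have [measurable]: "(\<lambda>y. \<Omega> *v y) \<in> borel_measurable borel" "(\<lambda>y. A *v y) \<in> borel_measurable borel"
    by (intro borel_measurable_continuous_onI continuous_intros)+
  show "(\<lambda>\<omega>. exp (\<xi> * (z \<omega> \<bullet> (\<Omega> *v z \<omega>)))) \<in> borel_measurable M"
    by measurable
  have pos: "0 < det \<Sigma>" "0 < det A"
    using \<Sigma> A by (simp_all add: sym_pos_def_det)
  let ?m = "matrix_inv A *v b"
  define E where "E = exp (1 / 2 * (b \<bullet> ?m - \<mu> \<bullet> b))"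
  define K where "K = E / sqrt ((2 * pi) ^ CARD('n) * det \<Sigma>)"
  have "0 \<le> K"
    using pos by (simp add: K_def E_def)
  have "(\<integral>\<^sup>+ \<omega>. ennreal (exp (\<xi> * (z \<omega> \<bullet> (\<Omega> *v z \<omega>)))) \<partial>M)
      = (\<integral>\<^sup>+ y. ennreal (mvn_density \<mu> \<Sigma> y) * ennreal (exp (\<xi> * (y \<bullet> (\<Omega> *v y)))) \<partial>lborel)"
    using distributed_nn_integral[OF dist, of "\<lambda>y. ennreal (exp (\<xi> * (y \<bullet> (\<Omega> *v y))))"] by simp
  also have "\<dots> = (\<integral>\<^sup>+ y. ennreal K * ennreal (exp (- (1 / 2) * ((y - ?m) \<bullet> (A *v (y - ?m))))) \<partial>lborel)"
  proof (rule nn_integral_cong)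
    fix y
    have "ennreal (mvn_density \<mu> \<Sigma> y) * ennreal (exp (\<xi> * (y \<bullet> (\<Omega> *v y))))
        = ennreal (mvn_density \<mu> \<Sigma> y * exp (\<xi> * (y \<bullet> (\<Omega> *v y))))"
      using pos by (intro ennreal_mult[symmetric]) (simp_all add: mvn_density_def)
    also have "\<dots> = ennreal (K * exp (- (1 / 2) * ((y - ?m) \<bullet> (A *v (y - ?m)))))"
      using mvn_density_times_exp_quadratic_form[OF \<Sigma> A[unfolded A_def], of \<mu> y]
      by (simp only: K_def E_def A_def b_def)
    also have "\<dots> = ennreal K * ennreal (exp (- (1 / 2) * ((y - ?m) \<bullet> (A *v (y - ?m)))))"
      using \<open>0 \<le> K\<close> by (rule ennreal_mult) simp
    finally show "ennreal (mvn_density \<mu> \<Sigma> y) * ennreal (exp (\<xi> * (y \<bullet> (\<Omega> *v y))))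
        = ennreal K * ennreal (exp (- (1 / 2) * ((y - ?m) \<bullet> (A *v (y - ?m)))))" .
  qed
  also have "\<dots> = ennreal K * ennreal (sqrt ((2 * pi) ^ CARD('n) / det A))"
    by (subst nn_integral_cmult) (simp_all only: nn_integral_gaussian_form[OF A], measurable)
  also have "\<dots> = ennreal (K * sqrt ((2 * pi) ^ CARD('n) / det A))"
    using \<open>0 \<le> K\<close> pos by (intro ennreal_mult[symmetric]) simp_all
  \<comment> \<open>The powers of \<open>2 * pi\<close> from the density and from the Gaussian
    integral cancel.\<close>
  also have "K * sqrt ((2 * pi) ^ CARD('n) / det A) = E / sqrt (det A * det \<Sigma>)"
    using pos by (simp add: K_def real_sqrt_mult real_sqrt_divide)
  finally show "(\<integral>\<^sup>+ \<omega>. ennreal (exp (\<xi> * (z \<omega> \<bullet> (\<Omega> *v z \<omega>)))) \<partial>M)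
      = ennreal (exp (1 / 2 * (b \<bullet> ?m - \<mu> \<bullet> b)) / sqrt (det A * det \<Sigma>))"
    by (simp only: E_def)
  show "0 \<le> exp (1 / 2 * (b \<bullet> ?m - \<mu> \<bullet> b)) / sqrt (det A * det \<Sigma>)"
    using pos by simp
qed simp

lemma sym_pos_def_shifted_precision:
  fixes \<Sigma> \<Omega> :: "real ^ 'n ^ 'n"
  assumes \<Sigma>: "sym_pos_def \<Sigma>" and \<Omega>: "sym_pos_def \<Omega>"
    and \<xi>: "\<xi> < 1 / (2 * lambda_max (\<Omega> ** \<Sigma>))"
  shows "sym_pos_def (matrix_inv \<Sigma> - (2 * \<xi>) *\<^sub>R \<Omega>)"
proof -
  let ?S = "matrix_inv \<Sigma>" and ?l = "lambda_max (\<Omega> ** \<Sigma>)"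
  note S = sym_pos_def_matrix_inv[OF \<Sigma>]
  have "0 < y \<bullet> (?S *v y) - 2 * \<xi> * (y \<bullet> (\<Omega> *v y))" if "y \<noteq> 0" for y
  proof -
    have s: "0 < y \<bullet> (?S *v y)" and o: "0 < y \<bullet> (\<Omega> *v y)"
      using that sym_pos_defD(2) S \<Omega> by blast+
    have le: "y \<bullet> (\<Omega> *v y) \<le> ?l * (y \<bullet> (?S *v y))"
      by (rule quadratic_form_le_lambda_max[OF sym_pos_defD(1)[OF \<Omega>] \<Sigma>])
    with o have "0 < ?l * (y \<bullet> (?S *v y))"
      by linarith
    \<comment> \<open>A positive eigenvalue bound allows the denominator in the condition on
      \<open>\<xi>\<close> to be cleared.\<close>
    with s have "0 < ?l"
      by (simp add: zero_less_mult_iff)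
    with \<xi> have "2 * \<xi> * ?l < 1"
      by (simp add: field_simps)
    \<comment> \<open>For \<open>\<xi> \<le> 0\<close> the subtracted term is nonpositive; for
      \<open>\<xi> > 0\<close> the bound \<open>le\<close> may be multiplied by
      \<open>2 * \<xi>\<close>.\<close>
    show ?thesis
    proof (cases "\<xi> \<le> 0")
      case True
      then have "2 * \<xi> * (y \<bullet> (\<Omega> *v y)) \<le> 0"
        using o by (simp add: mult_nonpos_nonneg)
      with s show ?thesis by linarith
    next
      case False
      then have "2 * \<xi> * (y \<bullet> (\<Omega> *v y)) \<le> 2 * \<xi> * (?l * (y \<bullet> (?S *v y)))"
        using le by simp
      also have "\<dots> = (2 * \<xi> * ?l) * (y \<bullet> (?S *v y))"
        by simp
      also have "\<dots> < y \<bullet> (?S *v y)"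
        using \<open>2 * \<xi> * ?l < 1\<close> s by simp
      finally show ?thesis by simp
    qed
  qed
  moreover have "transpose (?S - (2 * \<xi>) *\<^sub>R \<Omega>) = ?S - (2 * \<xi>) *\<^sub>R \<Omega>"
    using sym_pos_defD(1)[OF S] sym_pos_defD(1)[OF \<Omega>] by (simp add: transpose_def vec_eq_iff)
  ultimately show ?thesis
    by (simp add: sym_pos_def_def matrix_vector_mult_diff_rdistrib inner_diff_right
        flip: scaleR_matrix_vector_assoc)
qed

text \<open>The index type \<open>'k\<close> stands for the \<open>N\<close> time steps.
  Integrability belongs to the conclusion because the Bochner integral in \<open>mgf\<close>
  defaults to 0 without it.\<close>

theorem theorem1:
  fixes M :: "'a measure"
    and x :: "'k::finite \<Rightarrow> 'a \<Rightarrow> real ^ 'n"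
    and z :: "'a \<Rightarrow> real ^ ('k \<times> 'n)"
    and \<mu> :: "real ^ ('k \<times> 'n)"
    and \<Sigma> \<Omega> :: "real ^ ('k \<times> 'n) ^ ('k \<times> 'n)"
    and Q :: "real ^ 'n ^ 'n"
    and J :: "'a \<Rightarrow> real"
    and \<xi> :: real
  assumes "prob_space M"
    and "\<And>k. x k \<in> borel_measurable M"
    and "z = (\<lambda>\<omega>. stack (\<lambda>k. x k \<omega>))"
    and "sym_pos_def \<Sigma>"
    and "normally_distributed M z \<mu> \<Sigma>"
    and "sym_pos_def Q"
    and "\<Omega> = block_diag Q"
    and "J = (\<lambda>\<omega>. z \<omega> \<bullet> (\<Omega> *v z \<omega>))"
    and "\<xi> < 1 / (2 * lambda_max (\<Omega> ** \<Sigma>))"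
  shows "(\<forall>\<omega>. J \<omega> = (\<Sum>k\<in>UNIV. x k \<omega> \<bullet> (Q *v x k \<omega>))) \<and>
    integrable M (\<lambda>\<omega>. exp (\<xi> * J \<omega>)) \<and>
    mgf M J \<xi> =
      exp (1 / 2 * (\<mu> \<bullet> (((matrix_inv (mat 1 - (2 * \<xi>) *\<^sub>R (\<Omega> ** \<Sigma>)) - mat 1) ** matrix_inv \<Sigma>) *v \<mu>)))
      / sqrt (det (mat 1 - (2 * \<xi>) *\<^sub>R (\<Omega> ** \<Sigma>)))"
proof -
  let ?S = "matrix_inv \<Sigma>" and ?P = "mat 1 - (2 * \<xi>) *\<^sub>R (\<Omega> ** \<Sigma>)"
  define A where "A = ?S - (2 * \<xi>) *\<^sub>R \<Omega>"
  define b where "b = ?S *v \<mu>"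
  note \<Sigma> = \<open>sym_pos_def \<Sigma>\<close>
  have J: "J \<omega> = z \<omega> \<bullet> (\<Omega> *v z \<omega>)" for \<omega>
    by (simp add: assms)
  have J_sum: "\<forall>\<omega>. J \<omega> = (\<Sum>k\<in>UNIV. x k \<omega> \<bullet> (Q *v x k \<omega>))"
    by (simp add: assms stack_block_diag)
  have "sym_pos_def \<Omega>"
    unfolding \<open>\<Omega> = block_diag Q\<close> by (rule sym_pos_def_block_diag) fact
  with \<Sigma> have A: "sym_pos_def A"
    unfolding A_def using \<open>\<xi> < 1 / (2 * lambda_max (\<Omega> ** \<Sigma>))\<close> by (rule sym_pos_def_shifted_precision)
  have det: "det \<Sigma> \<noteq> 0" "det A \<noteq> 0"
    using sym_pos_def_det \<Sigma> A by fastforce+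
  \<comment> \<open>This factorisation gives both \<open>det ?P = det A * det \<Sigma>\<close> and
    the inverse of \<open>?P\<close>.\<close>
  have P: "?P = A ** \<Sigma>"
    by (simp add: A_def matrix_mult_diff_rdistrib matrix_inv_mult det scalar_matrix_assoc)
  have "(A ** \<Sigma>) ** (?S ** matrix_inv A) = A ** (\<Sigma> ** ?S) ** matrix_inv A"
    by (simp add: matrix_mul_assoc)
  then have Pinv: "matrix_inv ?P = ?S ** matrix_inv A"
    unfolding P by (intro matrix_inv_eqI) (simp add: matrix_inv_mult det)
  have "\<mu> \<bullet> (((matrix_inv ?P - mat 1) ** ?S) *v \<mu>) = \<mu> \<bullet> (?S *v (matrix_inv A *v b)) - \<mu> \<bullet> b"
    by (simp add: Pinv b_def matrix_mult_diff_rdistrib matrix_vector_mult_diff_rdistrib inner_diff_right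
        matrix_vector_mul_assoc matrix_mul_assoc)
  \<comment> \<open>Symmetry of \<open>?S\<close> moves it onto \<open>\<mu>\<close>, which turns
    the exponent into the one from completing the square.\<close>
  also have "\<mu> \<bullet> (?S *v (matrix_inv A *v b)) = b \<bullet> (matrix_inv A *v b)"
    unfolding b_def using inner_matrix_vector_symmetric[OF sym_pos_defD(1)[OF sym_pos_def_matrix_inv[OF \<Sigma>]]]
    by (metis inner_commute)
  finally have exponent: "\<mu> \<bullet> (((matrix_inv ?P - mat 1) ** ?S) *v \<mu>) = b \<bullet> (matrix_inv A *v b) - \<mu> \<bullet> b" .
  have "has_bochner_integral M (\<lambda>\<omega>. exp (\<xi> * J \<omega>))
      (exp (1 / 2 * (\<mu> \<bullet> (((matrix_inv ?P - mat 1) ** ?S) *v \<mu>))) / sqrt (det ?P))"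
    using has_bochner_integral_exp_quadratic_form[OF \<Sigma> A[unfolded A_def] \<open>normally_distributed M z \<mu> \<Sigma>\<close>]
    unfolding exponent unfolding J P det_mul by (simp only: A_def b_def)
  then show ?thesis
    using J_sum by (auto simp: mgf_def has_bochner_integral_iff)
qed

end
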